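(* Let $\succsim=(\succsim_1,\dots,\succsim_n)$ be a preference profile over objects. An assignment $p$ is necessarily Pareto optimal with respect to $\succsim$ if and only if it is Pareto optimal under all completions of the responsive set extension, i.e. for every profile $(R_1,\dots,R_n)$ in which each $R_i$ is a completion of $\succsim_i^{RS}$, $p$ is Pareto optimal with respect to $(R_1,\dots,R_n)$.
   Context: $N=\{1,\dots,n\}$ is a set of agents and $O=\{o_1,\dots,o_m\}$ a set of objects. An assignment $p=(p(1),\dots,p(n))$ is a partition of $O$ into $n$ (possibly empty) subsets, $p(i)$ being the bundle of agent $i$. Each agent $i$ has a complete, transitive, reflexive preference relation $\succsim_i$ over $O$. $\mathcal U(\succsim)$ is the set of utility profiles $u=(u_1,\dots,u_n)$ with $u_i:O\to\mathbb R_{>0}$ consistent with $\succsim_i$ (i.e. $u_i(o)\ge u_i(o')$ iff $o\succsim_i o'$), extended additively to bundles. For a given $u$, $q$ Pareto dominates $p$ if $u_i(q(i))\ge u_i(p(i))$ for all $i$ and $u_i(q(i))>u_i(p(i))$ for some $i$; $p$ is Pareto optimal for $u$ if no assignment Pareto dominates it. $p$ is necessarily Pareto optimal with respect to $\succsim$ if $p$ is Pareto optimal for every $u\in\mathcal U(\succsim)$. Responsive set extension: for $S,T\subseteq O$, $S\succsim_i^{RS}T$ if and only if there exists an injection $f:T\to S$ with $f(o)\succsim_i o$ for each $o\in T$; $S\succ_i^{RS}T$ means $S\succsim_i^{RS}T$ and not $T\succsim_i^{RS}S$. A completion of $\succsim_i^{RS}$ is a complete and transitive relation $R_i$ over $2^O$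 consistent with $\succsim_i^{RS}$: $S\succsim_i^{RS}T$ implies $S\,R_i\,T$, and $S\succ_i^{RS}T$ implies that $S$ is strictly preferred to $T$ under $R_i$ (i.e. not $T\,R_i\,S$). Pareto optimality of $p$ with respect to $(R_1,\dots,R_n)$ means there is no assignment $q$ with $q(i)\,R_i\,p(i)$ for all $i$ and, for some $i$, not $p(i)\,R_i\,q(i)$. *)

theory Defs
  imports Complex_Main "HOL-Library.Disjoint_Sets"
begin

text \<open>
  Agents are the numbers in \<open>{1..n}\<close>; \<open>Ob\<close> is the set of objects.
  A pair \<open>(x, y)\<close> in a preference relation means that \<open>x\<close> is weakly preferred to \<open>y\<close>.
  Profiles and assignments are functions on \<open>nat\<close>, of which only the values at \<open>{1..n}\<close>
  are ever used.
\<close>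

definition preference_profile :: "nat \<Rightarrow> 'a set \<Rightarrow> (nat \<Rightarrow> 'a rel) \<Rightarrow> bool" where
  "preference_profile n Ob pref \<longleftrightarrow>
     (\<forall>i\<in>{1..n}. preorder_on Ob (pref i) \<and> total_on Ob (pref i))"

definition assignment :: "nat \<Rightarrow> 'a set \<Rightarrow> (nat \<Rightarrow> 'a set) \<Rightarrow> bool" where
  "assignment n Ob p \<longleftrightarrow> (\<Union>i\<in>{1..n}. p i) = Ob \<and> disjoint_family_on p {1..n}"

definition consistent_utilities ::
    "nat \<Rightarrow> 'a set \<Rightarrow> (nat \<Rightarrow> 'a rel) \<Rightarrow> (nat \<Rightarrow> 'a \<Rightarrow> real) set" where
  "consistent_utilities n Ob pref =
     {u. \<forall>i\<in>{1..n}. (\<forall>x\<in>Ob. u i x > 0) \<and>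
                    (\<forall>x\<in>Ob. \<forall>y\<in>Ob. u i x \<ge> u i y \<longleftrightarrow> (x, y) \<in> pref i)}"

definition bundle_utility :: "('a \<Rightarrow> real) \<Rightarrow> 'a set \<Rightarrow> real" where
  "bundle_utility v S = (\<Sum>x\<in>S. v x)"

definition pareto_dominates_util ::
    "nat \<Rightarrow> (nat \<Rightarrow> 'a \<Rightarrow> real) \<Rightarrow> (nat \<Rightarrow> 'a set) \<Rightarrow> (nat \<Rightarrow> 'a set) \<Rightarrow> bool" where
  "pareto_dominates_util n u q p \<longleftrightarrow>
     (\<forall>i\<in>{1..n}. bundle_utility (u i) (q i) \<ge> bundle_utility (u i) (p i)) \<and>
     (\<exists>i\<in>{1..n}. bundle_utility (u i) (q i) > bundle_utility (u i) (p i))"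

definition pareto_optimal_util ::
    "nat \<Rightarrow> 'a set \<Rightarrow> (nat \<Rightarrow> 'a \<Rightarrow> real) \<Rightarrow> (nat \<Rightarrow> 'a set) \<Rightarrow> bool" where
  "pareto_optimal_util n Ob u p \<longleftrightarrow>
     \<not> (\<exists>q. assignment n Ob q \<and> pareto_dominates_util n u q p)"

definition necessarily_pareto_optimal ::
    "nat \<Rightarrow> 'a set \<Rightarrow> (nat \<Rightarrow> 'a rel) \<Rightarrow> (nat \<Rightarrow> 'a set) \<Rightarrow> bool" where
  "necessarily_pareto_optimal n Ob pref p \<longleftrightarrow>
     (\<forall>u\<in>consistent_utilities n Ob pref. pareto_optimal_util n Ob u p)"

definition responsive_ext :: "'a set \<Rightarrow> 'a rel \<Rightarrow> 'a set rel" where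
  "responsive_ext Ob r =
     {(S, T). S \<subseteq> Ob \<and> T \<subseteq> Ob \<and>
              (\<exists>f. inj_on f T \<and> f ` T \<subseteq> S \<and> (\<forall>x\<in>T. (f x, x) \<in> r))}"

text \<open>
  The library predicate \<open>total_on\<close> only compares distinct elements. Reflexivity of a completion
  on \<open>Pow Ob\<close> nevertheless follows, from the reflexivity of the responsive set extension.
\<close>

definition is_completion :: "'a set \<Rightarrow> 'a rel \<Rightarrow> 'a set rel \<Rightarrow> bool" where
  "is_completion Ob r R \<longleftrightarrow>
     R \<subseteq> Pow Ob \<times> Pow Ob \<and> total_on (Pow Ob) R \<and> trans R \<and>
     (\<forall>S T. (S, T) \<in> responsive_ext Ob r \<longrightarrow> (S, T) \<in> R) \<and>
     (\<forall>S T. (S, T) \<in> responsive_ext Ob r \<and> (T, S) \<notin> responsive_ext Ob r \<longrightarrow>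
            (S, T) \<in> R \<and> (T, S) \<notin> R)"

definition pareto_dominates_rel ::
    "nat \<Rightarrow> (nat \<Rightarrow> 'a set rel) \<Rightarrow> (nat \<Rightarrow> 'a set) \<Rightarrow> (nat \<Rightarrow> 'a set) \<Rightarrow> bool" where
  "pareto_dominates_rel n R q p \<longleftrightarrow>
     (\<forall>i\<in>{1..n}. (q i, p i) \<in> R i) \<and> (\<exists>i\<in>{1..n}. (p i, q i) \<notin> R i)"

definition pareto_optimal_rel ::
    "nat \<Rightarrow> 'a set \<Rightarrow> (nat \<Rightarrow> 'a set rel) \<Rightarrow> (nat \<Rightarrow> 'a set) \<Rightarrow> bool" where
  "pareto_optimal_rel n Ob R p \<longleftrightarrow>
     \<not> (\<exists>q. assignment n Ob q \<and> pareto_dominates_rel n R q p)"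

end

theory Submission
  imports Defs
begin

text \<open>
  Completions are compared with utilities one agent at a time. Every consistent additive utility
  induces a completion, which gives one direction. Conversely, if \<open>S\<close> is not RS-preferred to \<open>T\<close>,
  then \<open>T\<close> has more elements than \<open>S\<close> in some upper contour set, and a consistent utility that
  puts a large weight on that set makes \<open>T\<close> strictly better than \<open>S\<close>. So if \<open>q\<close> dominates \<open>p\<close>
  under completions, every agent for whom \<open>p(i)\<close> is not RS-preferred to \<open>q(i)\<close> can be given a
  utility strictly favouring \<open>q(i)\<close>; every other agent has \<open>q(i)\<close> RS-preferred to \<open>p(i)\<close>, hence
  weakly favours it under any utility.
\<close>

section \<open>Additive utilities as completions of the responsive extension\<close>

definition consistent_utility :: "'a set \<Rightarrow> 'a rel \<Rightarrow> ('a \<Rightarrow> real) \<Rightarrow> bool" where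
  "consistent_utility Ob r v \<longleftrightarrow>
     (\<forall>x\<in>Ob. v x > 0) \<and> (\<forall>x\<in>Ob. \<forall>y\<in>Ob. v x \<ge> v y \<longleftrightarrow> (x, y) \<in> r)"

lemma responsive_ext_utility_mono:
  assumes "finite Ob" "consistent_utility Ob r v" "(S, T) \<in> responsive_ext Ob r"
  shows "bundle_utility v T \<le> bundle_utility v S"
proof -
  obtain f where ST: "S \<subseteq> Ob" "T \<subseteq> Ob"
    and f: "inj_on f T" "f ` T \<subseteq> S" "\<And>x. x \<in> T \<Longrightarrow> (f x, x) \<in> r"
    using assms(3) by (auto simp: responsive_ext_def)
  have fin: "finite S" using ST assms(1) finite_subset by blast
  have "sum v T \<le> (\<Sum>x\<in>T. v (f x))"
    using assms(2) ST f by (intro sum_mono) (auto simp: consistent_utility_def subset_iff image_subset_iff)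
  also have "\<dots> = sum v (f ` T)"
    using f(1) by (simp add: sum.reindex)
  also have "\<dots> \<le> sum v S"
    using assms(2) ST f(2) fin
    by (intro sum_mono2) (auto simp: consistent_utility_def intro!: less_imp_le)
  finally show ?thesis by (simp add: bundle_utility_def)
qed

text \<open>Equality must hold throughout the estimate of the previous lemma. An object of
  \<open>S\<close> missed by \<open>f\<close> would add positive utility, and a strictly improved
  object would add a positive gap. So \<open>f\<close> is a bijection between objects of equal
  utility, and its inverse is the required injection. Contrapositively, a strict RS preference gives
  strictly larger utility, as a completion demands.\<close>

lemma responsive_ext_utility_eq:
  assumes "finite Ob" "consistent_utility Ob r v" "(S, T) \<in> responsive_ext Ob r"
    and le: "bundle_utility v S \<le> bundle_utility v T"
  shows "(T, S) \<in> responsive_ext Ob r"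
proof -
  obtain f where ST: "S \<subseteq> Ob" "T \<subseteq> Ob"
    and f: "inj_on f T" "f ` T \<subseteq> S" "\<And>x. x \<in> T \<Longrightarrow> (f x, x) \<in> r"
    using assms(3) by (auto simp: responsive_ext_def)
  have pos: "\<And>x. x \<in> Ob \<Longrightarrow> v x > 0"
    and cons: "\<And>x y. x \<in> Ob \<Longrightarrow> y \<in> Ob \<Longrightarrow> v x \<ge> v y \<longleftrightarrow> (x, y) \<in> r"
    using assms(2) by (auto simp: consistent_utility_def)
  have fin: "finite S" "finite T" using ST assms(1) finite_subset by blast+
  have vf: "v x \<le> v (f x)" if "x \<in> T" for x
    using that ST f cons by blast
  have "sum v S = sum v (f ` T) + sum v (S - f ` T)"
    using f(2) fin by (metis add.commute sum.subset_diff)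
  also have "sum v (f ` T) = (\<Sum>x\<in>T. v (f x))"
    using f(1) by (simp add: sum.reindex)
  finally have sum_S: "sum v S = (\<Sum>x\<in>T. v (f x)) + sum v (S - f ` T)" .
  have mono: "sum v T \<le> (\<Sum>x\<in>T. v (f x))"
    using vf by (intro sum_mono) auto
  have surj: "f ` T = S"
  proof (rule ccontr)
    assume "f ` T \<noteq> S"
    then have "0 < sum v (S - f ` T)"
      using f(2) fin ST pos by (intro sum_pos) auto
    then show False
      using sum_S mono le by (simp add: bundle_utility_def)
  qed
  have eq: "v (f x) = v x" if "x \<in> T" for x
  proof (rule ccontr)
    assume "v (f x) \<noteq> v x"
    with vf[OF that] have "sum v T < (\<Sum>x\<in>T. v (f x))"
      using vf fin that by (intro sum_strict_mono_ex1) force+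
    then show False
      using sum_S surj le by (simp add: bundle_utility_def)
  qed
  define g where "g = the_inv_into T f"
  have g: "g (f x) = x" if "x \<in> T" for x
    using that f(1) by (simp add: g_def the_inv_into_f_f)
  have "inj_on g S" using g surj by (metis imageE inj_onI)
  moreover have "g ` S \<subseteq> T" using g surj by auto
  moreover have "(g y, y) \<in> r" if "y \<in> S" for y
  proof -
    obtain x where x: "x \<in> T" "y = f x" using \<open>y \<in> S\<close> surj by blast
    then show ?thesis using cons[of x y] eq[of x] g ST that by auto
  qed
  ultimately show ?thesis
    using ST by (auto simp: responsive_ext_def)
qed

lemma is_completion_utility:
  assumes "finite Ob" "consistent_utility Ob r v"
  shows "is_completion Ob r
    {(S, T). S \<subseteq> Ob \<and> T \<subseteq> Ob \<and> bundle_utility v T \<le> bundle_utility v S}"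
proof -
  have "S \<subseteq> Ob" "T \<subseteq> Ob" "bundle_utility v T \<le> bundle_utility v S"
    if "(S, T) \<in> responsive_ext Ob r" for S T
    using that responsive_ext_utility_mono[OF assms] by (auto simp: responsive_ext_def)
  moreover have "\<not> bundle_utility v S \<le> bundle_utility v T"
    if "(S, T) \<in> responsive_ext Ob r" "(T, S) \<notin> responsive_ext Ob r" for S T
    using that responsive_ext_utility_eq[OF assms] by blast
  ultimately show ?thesis
    unfolding is_completion_def total_on_def trans_def
    by (simp add: subset_iff) (meson linear order_trans)
qed

section \<open>A Hall-type criterion for responsive preference\<close>

text \<open>This is Hall's theorem for the graph joining each \<open>t\<close> in \<open>T\<close>
  to the objects of \<open>S\<close> weakly preferred to it. The neighbourhoods form a chain, so a
  subset of \<open>T\<close> has the same neighbours as its least preferred element, and only the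
  upper contour sets have to be tested.\<close>

lemma upper_contour_injection:
  assumes "finite T" "finite S" "trans r" "refl_on T r" "total_on T r"
    and "\<And>t. t \<in> T \<Longrightarrow> card {x \<in> T. (x, t) \<in> r} \<le> card {x \<in> S. (x, t) \<in> r}"
  shows "\<exists>f. inj_on f T \<and> f ` T \<subseteq> S \<and> (\<forall>x\<in>T. (f x, x) \<in> r)"
  using assms
proof (induction "card T" arbitrary: T)
  case 0
  then show ?case by auto
next
  case (Suc k)
  \<comment> \<open>Remove a least preferred element \<open>t\<close>: everything already used for \<open>T - {t}\<close> is also
    acceptable for \<open>t\<close>, so the cardinality condition at \<open>t\<close> leaves a free object for it.\<close>
  have "\<exists>t\<in>T. \<forall>x\<in>T. (x, t) \<in> r"
  proof -
    \<comment> \<open>The inner induction runs over subsets \<open>U\<close> of a fixed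
      \<open>T\<close>, so that reflexivity and totality on \<open>T\<close> stay available.\<close>
    have "U \<noteq> {} \<Longrightarrow> U \<subseteq> T \<Longrightarrow> \<exists>t\<in>U. \<forall>x\<in>U. (x, t) \<in> r" if "finite U" for U
      using that
    proof (induction U rule: finite_induct)
      case (insert a U)
      have a: "a \<in> T" "(a, a) \<in> r"
        using insert.prems Suc.prems(4) by (auto simp: refl_on_def)
      show ?case
      proof (cases "U = {}")
        case False
        then obtain t where t: "t \<in> U" "\<forall>x\<in>U. (x, t) \<in> r" using insert by auto
        then have "t \<in> T" using insert.prems(2) by auto
        then have "(a, t) \<in> r \<or> (t, a) \<in> r"
          using Suc.prems(5) a unfolding total_on_def by metis
        then show ?thesis
        proof
          assume "(t, a) \<in> r"
          then have "\<forall>x\<in>insert a U. (x, a) \<in> r"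
            using t(2) a(2) transD[OF \<open>trans r\<close>] by blast
          then show ?thesis by blast
        qed (use t in blast)
      qed (use a in auto)
    qed auto
    moreover have "T \<noteq> {}" using Suc.hyps(2) by auto
    ultimately show ?thesis using Suc.prems(1) by blast
  qed
  then obtain t where t: "t \<in> T" "\<And>x. x \<in> T \<Longrightarrow> (x, t) \<in> r" by blast
  have "\<exists>f. inj_on f (T - {t}) \<and> f ` (T - {t}) \<subseteq> S \<and> (\<forall>x\<in>T - {t}. (f x, x) \<in> r)"
  proof (rule Suc.hyps(1))
    show "k = card (T - {t})" using Suc.hyps(2) Suc.prems(1) t by simp
    show "refl_on (T - {t}) r" using Suc.prems(4) by (auto simp: refl_on_def)
    show "total_on (T - {t}) r" using Suc.prems(5) by (auto simp: total_on_def)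
    fix s assume s: "s \<in> T - {t}"
    have "card {x \<in> T - {t}. (x, s) \<in> r} \<le> card {x \<in> T. (x, s) \<in> r}"
      using Suc.prems(1) by (intro card_mono) auto
    also have "\<dots> \<le> card {x \<in> S. (x, s) \<in> r}"
      using Suc.prems(6) s by auto
    finally show "card {x \<in> T - {t}. (x, s) \<in> r} \<le> card {x \<in> S. (x, s) \<in> r}" .
  qed (use Suc.prems in auto)
  then obtain f where f: "inj_on f (T - {t})" "f ` (T - {t}) \<subseteq> S"
    "\<And>x. x \<in> T - {t} \<Longrightarrow> (f x, x) \<in> r" by blast
  have "card (f ` (T - {t})) < card T"
    using f(1) t(1) Suc.prems(1) by (simp add: card_image card_Diff1_less del: card_Diff_insert)
  also have "card T = card {x \<in> T. (x, t) \<in> r}"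
    using t by (intro arg_cong[where f = card]) auto
  also have "\<dots> \<le> card {x \<in> S. (x, t) \<in> r}" using Suc.prems(6) t by blast
  finally have less: "card (f ` (T - {t})) < card {x \<in> S. (x, t) \<in> r}" .
  have "finite (f ` (T - {t}))" using Suc.prems(1) by simp
  then have "\<not> {x \<in> S. (x, t) \<in> r} \<subseteq> f ` (T - {t})"
    using less card_mono leD by metis
  then obtain y where y: "y \<in> S" "(y, t) \<in> r" "y \<notin> f ` (T - {t})" by blast
  have "inj_on (f(t := y)) T"
    using f(1) y(3) by (auto simp: inj_on_def)
  moreover have "(f(t := y)) ` T \<subseteq> S" using f(2) y(1) by auto
  moreover have "\<forall>x\<in>T. ((f(t := y)) x, x) \<in> r" using f(3) y(2) by auto
  ultimately show ?case by blast
qed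

section \<open>Utilities that detect a failure of responsive preference\<close>

text \<open>Lower contour sets of a total preorder are nested, so their sizes order the objects as
  \<open>r\<close> does; reflexivity makes them nonempty. This utility is the base that is modified
  below.\<close>

lemma consistent_utility_card:
  assumes "finite Ob" "preorder_on Ob r" "total_on Ob r"
  shows "consistent_utility Ob r (\<lambda>x. real (card {y \<in> Ob. (x, y) \<in> r}))"
proof -
  have r: "\<And>x. x \<in> Ob \<Longrightarrow> (x, x) \<in> r" and tr: "trans r"
    using assms(2) by (auto simp: preorder_on_def refl_on_def)
  have "card {z \<in> Ob. (y, z) \<in> r} \<le> card {z \<in> Ob. (x, z) \<in> r} \<longleftrightarrow> (x, y) \<in> r"
    if xy: "x \<in> Ob" "y \<in> Ob" for x y
  proof
    assume "(x, y) \<in> r"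
    then have "{z \<in> Ob. (y, z) \<in> r} \<subseteq> {z \<in> Ob. (x, z) \<in> r}"
      using tr by (blast intro: transD)
    then show "card {z \<in> Ob. (y, z) \<in> r} \<le> card {z \<in> Ob. (x, z) \<in> r}"
      using assms(1) by (simp add: card_mono)
  next
    assume le: "card {z \<in> Ob. (y, z) \<in> r} \<le> card {z \<in> Ob. (x, z) \<in> r}"
    show "(x, y) \<in> r"
    proof (rule ccontr)
      assume n: "(x, y) \<notin> r"
      then have "(y, x) \<in> r" using assms(3) xy r unfolding total_on_def by metis
      then have "{z \<in> Ob. (x, z) \<in> r} \<subseteq> {z \<in> Ob. (y, z) \<in> r}"
        using tr by (blast intro: transD)
      moreover have "y \<in> {z \<in> Ob. (y, z) \<in> r}" "y \<notin> {z \<in> Ob. (x, z) \<in> r}"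
        using n xy r by auto
      ultimately have "{z \<in> Ob. (x, z) \<in> r} \<subset> {z \<in> Ob. (y, z) \<in> r}"
        by (metis psubsetI)
      then have "card {z \<in> Ob. (x, z) \<in> r} < card {z \<in> Ob. (y, z) \<in> r}"
        using assms(1) by (intro psubset_card_mono) simp
      then show False using le by simp
    qed
  qed
  moreover have "card {z \<in> Ob. (x, z) \<in> r} > 0" if "x \<in> Ob" for x
    using that r assms(1) by (auto simp: card_gt_0_iff)
  ultimately show ?thesis by (auto simp: consistent_utility_def)
qed

lemma not_responsive_ext_utility:
  assumes "finite Ob" "preorder_on Ob r" "total_on Ob r" "S \<subseteq> Ob" "T \<subseteq> Ob"
    and "(S, T) \<notin> responsive_ext Ob r"
  shows "\<exists>v. consistent_utility Ob r v \<and> bundle_utility v S < bundle_utility v T"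
proof -
  have rfl: "\<And>x. x \<in> Ob \<Longrightarrow> (x, x) \<in> r" and tr: "trans r"
    using assms(2) by (auto simp: preorder_on_def refl_on_def)
  have fin: "finite S" "finite T" using assms finite_subset by blast+
  have "\<exists>t\<in>T. \<not> card {x \<in> T. (x, t) \<in> r} \<le> card {x \<in> S. (x, t) \<in> r}"
  proof (rule ccontr)
    assume "\<not> ?thesis"
    then have "\<exists>f. inj_on f T \<and> f ` T \<subseteq> S \<and> (\<forall>x\<in>T. (f x, x) \<in> r)"
      using assms(3,5) fin tr rfl
      by (intro upper_contour_injection) (auto simp: refl_on_def total_on_def subset_iff)
    then show False using assms(4-6) by (auto simp: responsive_ext_def)
  qed
  then obtain t where t: "t \<in> T"
    and card: "card {x \<in> S. (x, t) \<in> r} < card {x \<in> T. (x, t) \<in> r}"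
    by (auto simp: not_le)
  define w where "w x = real (card {y \<in> Ob. (x, y) \<in> r})" for x
  have w: "consistent_utility Ob r w"
    using consistent_utility_card[OF assms(1-3)] by (simp add: w_def[abs_def])
  have w0: "0 \<le> w x" for x by (simp add: w_def)
  \<comment> \<open>\<open>M\<close> exceeds the \<open>w\<close>-value of every bundle, so one more
    object above \<open>t\<close> outweighs any difference in \<open>w\<close>. The
    \<open>+ 1\<close> makes the comparison strict.\<close>
  define M where "M = sum w Ob + 1"
  have M: "M > 0" using w0 by (simp add: M_def add_nonneg_pos sum_nonneg)
  \<comment> \<open>A bonus on an upper contour set keeps the utility consistent: the set is upward
    closed, and every object outside it is strictly worse than every object inside.\<close>
  define v where "v x = w x + (if (x, t) \<in> r then M else 0)" for x
  have "v x \<ge> v y \<longleftrightarrow> (x, y) \<in> r" if "x \<in> Ob" "y \<in> Ob" for x y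
  proof -
    have "w x \<ge> w y \<longleftrightarrow> (x, y) \<in> r" using w that by (auto simp: consistent_utility_def)
    moreover have "(x, t) \<in> r" if "(x, y) \<in> r" "(y, t) \<in> r"
      using that tr by (meson transD)
    moreover have "(x, y) \<in> r" if "(x, t) \<in> r" "(y, t) \<notin> r"
    proof -
      have "t \<in> Ob" using t assms(5) by auto
      then have "(t, y) \<in> r"
        using that \<open>y \<in> Ob\<close> assms(3) rfl unfolding total_on_def by metis
      with that tr show ?thesis by (meson transD)
    qed
    ultimately show ?thesis using M by (auto simp: v_def)
  qed
  moreover have "v x > 0" if "x \<in> Ob" for x
    using w that M by (auto simp: v_def consistent_utility_def add_pos_pos)
  ultimately have "consistent_utility Ob r v" by (simp add: consistent_utility_def)
  moreover have "bundle_utility v S < bundle_utility v T"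
  proof -
    have sum_v: "sum v A = sum w A + M * card {x \<in> A. (x, t) \<in> r}" if "finite A" for A
      using that by (simp add: v_def sum.distrib sum.If_cases Int_def mult.commute)
    have "sum v S \<le> sum w Ob + M * card {x \<in> S. (x, t) \<in> r}"
      using assms(1,4) w0 fin by (simp add: sum_v sum_mono2)
    \<comment> \<open>By the choice of \<open>M\<close>, \<open>sum w Ob\<close> equals
      \<open>M - 1\<close>.\<close>
    also have "\<dots> < M * (real (card {x \<in> S. (x, t) \<in> r}) + 1)"
      by (simp add: M_def algebra_simps)
    also have "\<dots> \<le> M * card {x \<in> T. (x, t) \<in> r}"
      using card M by (intro mult_left_mono) auto
    also have "\<dots> \<le> sum v T"
      using fin w0 by (simp add: sum_v sum_nonneg)
    finally show ?thesis by (simp add: bundle_utility_def)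
  qed
  ultimately show ?thesis by blast
qed

lemma is_completion_weak_utility:
  assumes "finite Ob" "preorder_on Ob r" "total_on Ob r" "is_completion Ob r R" "(T, S) \<in> R"
  shows "\<exists>v. consistent_utility Ob r v \<and> bundle_utility v S \<le> bundle_utility v T \<and>
    ((S, T) \<notin> R \<longrightarrow> bundle_utility v S < bundle_utility v T)"
proof (cases "(S, T) \<in> responsive_ext Ob r")
  case True
  \<comment> \<open>If the first claim failed, \<open>S\<close> would be strictly RS-preferred to
    \<open>T\<close>, and the completion would exclude \<open>(T, S)\<close> from \<open>R\<close>.
    Hence all consistent utilities tie on \<open>S\<close> and \<open>T\<close>, and any of them
    serves.\<close>
  then have "(T, S) \<in> responsive_ext Ob r" "(S, T) \<in> R"
    using assms(4,5) by (auto simp: is_completion_def)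
  then show ?thesis
    using consistent_utility_card[OF assms(1-3)] responsive_ext_utility_mono[OF assms(1)] by blast
next
  case False
  have "S \<subseteq> Ob" "T \<subseteq> Ob" using assms(4,5) by (auto simp: is_completion_def)
  then show ?thesis
    using not_responsive_ext_utility[OF assms(1-3) _ _ False] less_imp_le by blast
qed

theorem theorem8:
  fixes n :: nat and Ob :: "'a set"
    and pref :: "nat \<Rightarrow> 'a rel" and p :: "nat \<Rightarrow> 'a set"
  assumes "finite Ob"
    and "preference_profile n Ob pref"
    and "assignment n Ob p"
  shows "necessarily_pareto_optimal n Ob pref p \<longleftrightarrow>
    (\<forall>R. (\<forall>i\<in>{1..n}. is_completion Ob (pref i) (R i)) \<longrightarrow> pareto_optimal_rel n Ob R p)"
proof -
  have utilities: "u \<in> consistent_utilities n Ob pref \<longleftrightarrow>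
      (\<forall>i\<in>{1..n}. consistent_utility Ob (pref i) (u i))" for u
    by (simp add: consistent_utilities_def consistent_utility_def)
  show ?thesis
  proof (intro iffI allI impI)
    fix R
    assume npo: "necessarily_pareto_optimal n Ob pref p"
      and R: "\<forall>i\<in>{1..n}. is_completion Ob (pref i) (R i)"
    show "pareto_optimal_rel n Ob R p"
      unfolding pareto_optimal_rel_def
    proof
      assume "\<exists>q. assignment n Ob q \<and> pareto_dominates_rel n R q p"
      then obtain q where q: "assignment n Ob q" "pareto_dominates_rel n R q p" by blast
      have "\<forall>i\<in>{1..n}. \<exists>v. consistent_utility Ob (pref i) v \<and>
          bundle_utility v (p i) \<le> bundle_utility v (q i) \<and>
          ((p i, q i) \<notin> R i \<longrightarrow> bundle_utility v (p i) < bundle_utility v (q i))"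
        using assms(1,2) R q(2)
        by (intro ballI is_completion_weak_utility)
          (auto simp: preference_profile_def pareto_dominates_rel_def)
      \<comment> \<open>Consistency is a condition on each agent separately, so utilities chosen
        agent by agent, each depending on the bundles under \<open>p\<close> and \<open>q\<close>,
        form an admissible profile.\<close>
      then obtain u where u: "\<forall>i\<in>{1..n}. consistent_utility Ob (pref i) (u i) \<and>
          bundle_utility (u i) (p i) \<le> bundle_utility (u i) (q i) \<and>
          ((p i, q i) \<notin> R i \<longrightarrow> bundle_utility (u i) (p i) < bundle_utility (u i) (q i))"
        by metis
      then have "pareto_dominates_util n u q p"
        using q(2) by (auto simp: pareto_dominates_util_def pareto_dominates_rel_def)
      moreover have "u \<in> consistent_utilities n Ob pref" using u utilities by blast
      ultimately show False
        using npo q(1) by (auto simp: necessarily_pareto_optimal_def pareto_optimal_util_def)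
    qed
  next
    assume po: "\<forall>R. (\<forall>i\<in>{1..n}. is_completion Ob (pref i) (R i)) \<longrightarrow> pareto_optimal_rel n Ob R p"
    show "necessarily_pareto_optimal n Ob pref p"
      unfolding necessarily_pareto_optimal_def pareto_optimal_util_def
    proof (intro ballI notI)
      fix u
      assume u: "u \<in> consistent_utilities n Ob pref"
        and "\<exists>q. assignment n Ob q \<and> pareto_dominates_util n u q p"
      then obtain q where q: "assignment n Ob q" "pareto_dominates_util n u q p" by blast
      \<comment> \<open>For these completions, domination between assignments coincides with
        domination under \<open>u\<close>. The restriction to subsets of \<open>Ob\<close> is
        harmless because the bundles of an assignment lie in \<open>Ob\<close>.\<close>
      define R where "R i = {(S, T). S \<subseteq> Ob \<and> T \<subseteq> Ob \<and>
        bundle_utility (u i) T \<le> bundle_utility (u i) S}" for i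
      have "\<forall>i\<in>{1..n}. is_completion Ob (pref i) (R i)"
        using u utilities is_completion_utility[OF assms(1)] by (simp add: R_def)
      then have "pareto_optimal_rel n Ob R p" using po by blast
      moreover have "\<forall>i\<in>{1..n}. p i \<subseteq> Ob \<and> q i \<subseteq> Ob"
        using assms(3) q(1) by (auto simp: assignment_def)
      then have "pareto_dominates_rel n R q p"
        using q(2) by (auto simp: pareto_dominates_rel_def pareto_dominates_util_def R_def not_le)
      ultimately show False using q(1) by (auto simp: pareto_optimal_rel_def)
    qed
  qed
qed

end
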